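(* There is an algorithm that, given the codes $x^c,y^c\in\{0,1\}^{n-3}$ of two pyramidal tours $x,y\in PT_n$, decides whether the vertices $x^v$ and $y^v$ of $\mathrm{PYR}(n)$ are adjacent in time $O(n)$.
   Context: Let $K_n$ be the complete undirected graph on vertex set $\{1,\dots,n\}$ with edge set $E$. A Hamiltonian cycle $\langle 1,i_1,\dots,i_r,n,j_1,\dots,j_{n-r-2}\rangle$ is called a pyramidal tour if $i_1<i_2<\dots<i_r$ and $j_1>j_2>\dots>j_{n-r-2}$; tours are undirected. Let $PT_n$ be the set of all pyramidal tours. For $x\in PT_n$ its characteristic vector $x^v\in\mathbb{R}^E$ has $x^v_e=1$ if edge $e$ lies in $x$ and $0$ otherwise. The pyramidal tours polytope is $\mathrm{PYR}(n)=\operatorname{conv}\{x^v : x\in PT_n\}$. Every pyramidal tour contains the edge $\{1,2\}$; the tour is oriented so that vertex $2$ belongs to the increasing part. The code of $x$ is the $0/1$ vector $x^c=(x^c_3,\dots,x^c_{n-1})$ with $x^c_i=1$ if vertex $i$ is visited in the increasing part of $x$ and $x^c_i=0$ otherwise; $x\mapsto x^c$ is a bijection from $PT_n$ onto $\{0,1\}^{n-3}$. *)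

theory Defs
  imports "HOL-Analysis.Analysis" "HOL-Library.Function_Algebras"
begin

instantiation "fun" :: (type, real_vector) real_vector
begin
definition scaleR_fun :: "real \<Rightarrow> ('a \<Rightarrow> 'b) \<Rightarrow> 'a \<Rightarrow> 'b"
  where "scaleR_fun r f = (\<lambda>x. r *\<^sub>R f x)"
instance
  by standard (auto simp: scaleR_fun_def fun_eq_iff scaleR_add_right scaleR_add_left)
end

definition pyr_seq :: "nat \<Rightarrow> nat list \<Rightarrow> bool" where
  "pyr_seq n xs \<longleftrightarrow> distinct xs \<and> set xs = {1..n} \<and>
     (\<exists>is js. xs = 1 # is @ n # js \<and> sorted_wrt (<) is \<and> sorted_wrt (>) js)"

definition tour_edges :: "nat list \<Rightarrow> nat set set" where
  "tour_edges xs = {{xs ! i, xs ! ((i + 1) mod length xs)} | i. i < length xs}"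

definition PT :: "nat \<Rightarrow> nat set set set" where
  "PT n = tour_edges ` {xs. pyr_seq n xs}"

definition charvec :: "nat set set \<Rightarrow> (nat set \<Rightarrow> real)" where
  "charvec T = (\<lambda>e. if e \<in> T then 1 else 0)"

definition PYR :: "nat \<Rightarrow> (nat set \<Rightarrow> real) set" where
  "PYR n = convex hull (charvec ` PT n)"

definition adjacent_vertices :: "'a::real_vector set \<Rightarrow> 'a \<Rightarrow> 'a \<Rightarrow> bool" where
  "adjacent_vertices P u w \<longleftrightarrow> u \<noteq> w \<and> closed_segment u w face_of P"

text \<open>Code of a pyramidal tour given by a sequence oriented so that 2 follows 1:
  entry for vertex i (i = 3..n-1) is True iff i lies in the increasing part,
  i.e. before n in the sequence.\<close>

definition code_of :: "nat \<Rightarrow> nat list \<Rightarrow> bool list" where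
  "code_of n xs = map (\<lambda>i. i \<in> set (takeWhile (\<lambda>v. v \<noteq> n) xs)) [3..<n]"

datatype instr =
    LoadC nat nat
  | Add nat nat nat
  | Sub nat nat nat
  | LoadI nat nat
  | StoreI nat nat
  | Jz nat nat
  | Jmp nat
  | Halt

type_synonym config = "nat \<times> (nat \<Rightarrow> nat)"

definition halted :: "instr list \<Rightarrow> config \<Rightarrow> bool" where
  "halted p c \<longleftrightarrow> fst c \<ge> length p \<or> p ! fst c = Halt"

fun exec_instr :: "instr \<Rightarrow> config \<Rightarrow> config" where
  "exec_instr (LoadC r k) (pc, m) = (pc + 1, m(r := k))"
| "exec_instr (Add r s t) (pc, m) = (pc + 1, m(r := m s + m t))"
| "exec_instr (Sub r s t) (pc, m) = (pc + 1, m(r := m s - m t))"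
| "exec_instr (LoadI r s) (pc, m) = (pc + 1, m(r := m (m s)))"
| "exec_instr (StoreI r s) (pc, m) = (pc + 1, m(m r := m s))"
| "exec_instr (Jz r l) (pc, m) = (if m r = 0 then (l, m) else (pc + 1, m))"
| "exec_instr (Jmp l) (pc, m) = (l, m)"
| "exec_instr Halt (pc, m) = (pc, m)"

definition step :: "instr list \<Rightarrow> config \<Rightarrow> config" where
  "step p c = (if halted p c then c else exec_instr (p ! fst c) c)"

definition run :: "instr list \<Rightarrow> nat \<Rightarrow> config \<Rightarrow> config" where
  "run p t c = (step p ^^ t) c"

text \<open>Input encoding for two codes of length n-3: M[0] = n, M[1+k] = x^c_{k+3},
  M[n-2+k] = y^c_{k+3} (bits as 0/1), all other registers 0; pc starts at 0.\<close>

definition bit :: "bool \<Rightarrow> nat" where "bit b = (if b then 1 else 0)"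

definition init_mem :: "nat \<Rightarrow> bool list \<Rightarrow> bool list \<Rightarrow> nat \<Rightarrow> nat" where
  "init_mem n xc yc = (\<lambda>a. if a = 0 then n
      else if 1 \<le> a \<and> a < 1 + length xc then bit (xc ! (a - 1))
      else if 1 + length xc \<le> a \<and> a < 1 + length xc + length yc
        then bit (yc ! (a - 1 - length xc))
      else 0)"

definition decides_within :: "instr list \<Rightarrow> (nat \<Rightarrow> nat) \<Rightarrow> bool \<Rightarrow> nat \<Rightarrow> bool" where
  "decides_within p m0 b t \<longleftrightarrow>
     halted p (run p t (0, m0)) \<and> snd (run p t (0, m0)) 0 = bit b"

end

theory Submission
  imports Defs
begin

text \<open>
  Call a vertex \<open>k\<close> a node of a tour if \<open>k = 2\<close>, \<open>k = n\<close>, or \<open>k - 1\<close> and \<open>k\<close> lie in different parts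
  of the tour.  Two nodes \<open>a < b\<close> that are consecutive in this sense contribute the edge
  \<open>{a - 1, b}\<close>, and every non-node \<open>k\<close> contributes \<open>{k - 1, k}\<close>.  So tours correspond to paths from
  \<open>2\<close> to \<open>n\<close> in the complete acyclic digraph on \<open>{2..n}\<close>, and two tours are adjacent iff their paths
  separate and rejoin exactly once: if the paths differ both before and after a common node \<open>m\<close>,
  exchanging their tails at \<open>m\<close> gives two other tours with the same sum of characteristic vectors;
  otherwise the two tours are the only ones contained in the union of their edge sets, and the
  number of edges outside this union is a linear functional exposing the segment.

  Scanning the vertices, one counts how often a node of exactly one tour and a node of both tours
  alternate, starting with the former; the tours are adjacent iff this count is \<open>1\<close> or \<open>2\<close>.
\<close>

section \<open>Edges of pyramidal tours\<close>

fun steps :: "'a list \<Rightarrow> 'a set set" where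
  "steps (a # b # l) = insert {a, b} (steps (b # l))"
| "steps _ = {}"

lemma steps_append: "steps (xs @ a # ys) = steps (xs @ [a]) \<union> steps (a # ys)"
  by (induction xs rule: steps.induct) auto

lemma steps_rev: "steps (rev l) = steps l"
proof (induction l rule: steps.induct)
  case (1 a b l)
  then show ?case
    using steps_append[of "rev l" b "[a]"] by (auto simp: insert_commute)
qed auto

lemma steps_conv_nth: "steps l = {{l ! i, l ! Suc i} | i. Suc i < length l}"
proof (induction l rule: steps.induct)
  case (1 a b l)
  have "{{(a # b # l) ! i, (a # b # l) ! Suc i} | i. Suc i < length (a # b # l)} =
        insert {a, b} {{(b # l) ! i, (b # l) ! Suc i} | i. Suc i < length (b # l)}"
    (is "?L = ?R")
  proof
    show "?L \<subseteq> ?R"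
    proof
      fix e assume "e \<in> ?L"
      then obtain i where "e = {(a # b # l) ! i, (a # b # l) ! Suc i}" "Suc i < length (a # b # l)"
        by blast
      then show "e \<in> ?R" by (cases i) auto
    qed
    show "?R \<subseteq> ?L"
    proof
      fix e assume "e \<in> ?R"
      then consider "e = {a, b}" | i where "e = {(b # l) ! i, (b # l) ! Suc i}" "Suc i < length (b # l)"
        by blast
      then show "e \<in> ?L"
      proof cases
        case 1
        then show ?thesis by (auto intro!: exI[of _ 0])
      next
        case (2 i)
        then show ?thesis by (auto intro!: exI[of _ "Suc i"])
      qed
    qed
  qed
  with 1 show ?case by simp
qed auto

text \<open>Repeating the first vertex at the end turns the cyclic successor, taken modulo the
  length, into an ordinary path step.\<close>

lemma tour_edges_steps: "tour_edges (x # l) = steps (x # l @ [x])"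
proof -
  have "(x # l @ [x]) ! i = (x # l) ! i \<and>
      (x # l @ [x]) ! Suc i = (x # l) ! ((i + 1) mod length (x # l))" if "i < length (x # l)" for i
    using that by (cases "i = length l") (auto simp: nth_append nth_Cons')
  then show ?thesis
    unfolding tour_edges_def steps_conv_nth by (auto; metis)
qed

text \<open>In an increasing list, which pairs are consecutive depends only on the set of
  entries.\<close>

lemma steps_sorted_wrt:
  assumes "sorted_wrt (<) (l :: nat list)" "i < j"
  shows "{i, j} \<in> steps l \<longleftrightarrow> i \<in> set l \<and> j \<in> set l \<and> (\<forall>k \<in> set l. \<not> (i < k \<and> k < j))"
  using assms
proof (induction l rule: steps.induct)
  case (1 a b l)
  have "a < b" "\<forall>k\<in>set l. b < k" using "1.prems" by auto
  with 1 show ?case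
    by (auto simp: doubleton_eq_iff; fastforce)
qed auto

lemma steps_sorted_wrt_form:
  "sorted_wrt (<) (l :: nat list) \<Longrightarrow> e \<in> steps l \<Longrightarrow> \<exists>i j. e = {i, j} \<and> i < j \<and> i \<in> set l \<and> j \<in> set l"
proof (induction l rule: steps.induct)
  case (1 a b l)
  then show ?case
    by (cases "e = {a, b}") (auto 4 3)
qed auto

section \<open>Tours described by their node sets\<close>

definition ascending :: "nat \<Rightarrow> nat list \<Rightarrow> nat \<Rightarrow> bool" where
  "ascending n xs i \<longleftrightarrow> i \<in> set (takeWhile (\<lambda>v. v \<noteq> n) xs)"

definition nodes :: "nat \<Rightarrow> (nat \<Rightarrow> bool) \<Rightarrow> nat set" where
  "nodes n c = {k. 2 \<le> k \<and> k \<le> n \<and> (k = 2 \<or> k = n \<or> c (k - 1) \<noteq> c k)}"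

text \<open>Consecutive nodes \<open>Suc i\<close> and \<open>j\<close> give the edge
  \<open>{i, j}\<close>. The edges \<open>{1, 2}\<close> and \<open>{n - 1, n}\<close> lie in every
  tour although \<open>2\<close> and \<open>n\<close> are nodes, hence the exceptions in the first
  case.\<close>

definition link :: "nat \<Rightarrow> nat set \<Rightarrow> nat \<Rightarrow> nat \<Rightarrow> bool" where
  "link n N i j \<longleftrightarrow>
     (if j = Suc i then j = 2 \<or> j = n \<or> j \<notin> N
      else Suc i \<in> N \<and> j \<in> N \<and> (\<forall>k. Suc i < k \<and> k < j \<longrightarrow> k \<notin> N))"

definition edges_of :: "nat \<Rightarrow> nat set \<Rightarrow> nat set set" where
  "edges_of n N = {{i, j} | i j. 1 \<le> i \<and> i < j \<and> j \<le> n \<and> link n N i j}"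

text \<open>The right-hand side says that \<open>i\<close> and \<open>j\<close> are consecutive in
  the part with value \<open>b\<close>, where \<open>1\<close> and \<open>n\<close> belong to both
  parts. If \<open>j > Suc i\<close>, having no node strictly between \<open>Suc i\<close> and
  \<open>j\<close> means that \<open>c\<close> is constant strictly between \<open>i\<close> and
  \<open>j\<close>, and \<open>b\<close> is the opposite value.\<close>

lemma link_nodes_iff:
  assumes "1 \<le> i" "i < j" "j \<le> n" "3 \<le> n"
  shows "link n (nodes n c) i j \<longleftrightarrow>
    (\<exists>b. (i = 1 \<or> c i = b) \<and> (j = n \<or> c j = b) \<and> (\<forall>k. i < k \<and> k < j \<longrightarrow> c k \<noteq> b))"
proof (cases "j = Suc i")
  case True
  have "link n (nodes n c) i j \<longleftrightarrow> i = 1 \<or> j = n \<or> c i = c j"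
    using True assms by (simp add: link_def nodes_def) linarith
  also have "\<dots> \<longleftrightarrow> (\<exists>b. (i = 1 \<or> c i = b) \<and> (j = n \<or> c j = b))"
    by metis
  also have "\<dots> \<longleftrightarrow>
      (\<exists>b. (i = 1 \<or> c i = b) \<and> (j = n \<or> c j = b) \<and> (\<forall>k. i < k \<and> k < j \<longrightarrow> c k \<noteq> b))"
  proof -
    have "\<not> (i < k \<and> k < j)" for k using True by linarith
    then show ?thesis by blast
  qed
  finally show ?thesis .
next
  case False
  with assms have lt: "Suc i < j" by simp
  have node_i: "Suc i \<in> nodes n c \<longleftrightarrow> i = 1 \<or> c i \<noteq> c (Suc i)"
    using assms lt by (simp add: nodes_def)
  have node_j: "j \<in> nodes n c \<longleftrightarrow> j = n \<or> c (j - 1) \<noteq> c j"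
    using assms lt by (simp add: nodes_def)
  have node: "Suc k \<in> nodes n c \<longleftrightarrow> c k \<noteq> c (Suc k)" if "i < k" "Suc k < j" for k
    using assms that by (simp add: nodes_def)
  have link: "link n (nodes n c) i j \<longleftrightarrow> Suc i \<in> nodes n c \<and> j \<in> nodes n c \<and>
      (\<forall>k. i < k \<and> Suc k < j \<longrightarrow> Suc k \<notin> nodes n c)"
    using lt by (simp add: link_def) (metis Suc_lessE Suc_less_eq)
  show ?thesis
  proof
    assume L: "link n (nodes n c) i j"
    have const: "i < k \<longrightarrow> k < j \<longrightarrow> c k = c (Suc i)" for k
    proof (induction k)
      case (Suc k)
      show ?case
      proof (intro impI)
        assume k: "i < Suc k" "Suc k < j"
        show "c (Suc k) = c (Suc i)"
        proof (cases "k = i")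
          case False
          then have "Suc k \<notin> nodes n c" using L link k by simp
          then show ?thesis using node[of k] Suc False k by simp
        qed simp
      qed
    qed simp
    have "c (j - 1) = c (Suc i)" using lt by (intro const[rule_format]) auto
    then have "(i = 1 \<or> c i = (\<not> c (Suc i))) \<and> (j = n \<or> c j = (\<not> c (Suc i)))"
      using L unfolding link node_i node_j by argo
    moreover have "\<forall>k. i < k \<and> k < j \<longrightarrow> c k \<noteq> (\<not> c (Suc i))"
      using const by blast
    ultimately show "\<exists>b. (i = 1 \<or> c i = b) \<and> (j = n \<or> c j = b) \<and> (\<forall>k. i < k \<and> k < j \<longrightarrow> c k \<noteq> b)"
      by blast
  next
    assume "\<exists>b. (i = 1 \<or> c i = b) \<and> (j = n \<or> c j = b) \<and> (\<forall>k. i < k \<and> k < j \<longrightarrow> c k \<noteq> b)"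
    then obtain b where b: "i = 1 \<or> c i = b" "j = n \<or> c j = b" "\<And>k. i < k \<Longrightarrow> k < j \<Longrightarrow> c k = (\<not> b)"
      by blast
    show "link n (nodes n c) i j"
      unfolding link node_i node_j
      using b(1,2) b(3)[of "Suc i"] b(3)[of "j - 1"] node b(3) lt by auto
  qed
qed

text \<open>Reading the part after \<open>n\<close> backwards splits the tour into two increasing
  paths from \<open>1\<close> to \<open>n\<close>.\<close>

lemma pyr_seqE:
  assumes "pyr_seq n xs" "3 \<le> n"
  obtains us ws where "xs = 1 # us @ n # ws" "sorted_wrt (<) (1 # us @ [n])"
    "sorted_wrt (<) (1 # rev ws @ [n])"
    "set us = {i. 2 \<le> i \<and> i < n \<and> ascending n xs i}"
    "set ws = {i. 2 \<le> i \<and> i < n \<and> \<not> ascending n xs i}"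
proof -
  obtain us ws where xs: "xs = 1 # us @ n # ws" "sorted_wrt (<) us" "sorted_wrt (>) ws"
    and d: "distinct xs" "set xs = {1..n}"
    using assms(1) unfolding pyr_seq_def by blast
  have n: "n \<notin> set us" "n \<notin> set ws" "1 \<notin> set us" "1 \<notin> set ws" "set us \<inter> set ws = {}"
    using d(1) unfolding xs(1) by simp_all
  have "set xs = {1, n} \<union> set us \<union> set ws"
    unfolding xs(1) by auto
  then have all: "{1..n} = {1, n} \<union> set us \<union> set ws"
    using d(2) by simp
  have b: "1 < i \<and> i < n" if "i \<in> set us \<or> i \<in> set ws" for i
  proof -
    have "i \<in> {1..n}" using that unfolding all by blast
    moreover have "i \<noteq> 1" "i \<noteq> n" using n that by blast+
    ultimately show ?thesis by simp
  qed
  have "takeWhile (\<lambda>v. v \<noteq> n) (1 # us @ n # ws) = 1 # takeWhile (\<lambda>v. v \<noteq> n) (us @ n # ws)"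
    using assms(2) by simp
  also have "takeWhile (\<lambda>v. v \<noteq> n) (us @ n # ws) = us"
    unfolding takeWhile_append using n(1) by auto
  finally have asc: "ascending n xs i \<longleftrightarrow> i = 1 \<or> i \<in> set us" for i
    by (simp add: ascending_def xs(1))
  have mem: "i \<in> set us \<or> i \<in> set ws" if "2 \<le> i" "i < n" for i
  proof -
    have "i \<in> {1..n}" using that by simp
    then show ?thesis using that unfolding all by auto
  qed
  show thesis
  proof (rule that[OF xs(1)])
    show "sorted_wrt (<) (1 # us @ [n])" "sorted_wrt (<) (1 # rev ws @ [n])"
      using b xs(2,3) assms(2) by (simp_all add: sorted_wrt_append sorted_wrt_rev)
    show "set us = {i. 2 \<le> i \<and> i < n \<and> ascending n xs i}"
      unfolding asc using b by force
    show "set ws = {i. 2 \<le> i \<and> i < n \<and> \<not> ascending n xs i}"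
      unfolding asc using b n(5) mem by fastforce
  qed
qed

text \<open>An edge is a consecutive pair of one of the two increasing paths; by
  \<open>steps_sorted_wrt\<close> this is the existential over \<open>b\<close> in
  \<open>link_nodes_iff\<close>.\<close>

lemma tour_edges_pyr_seq:
  assumes "pyr_seq n xs" "3 \<le> n"
  shows "tour_edges xs = edges_of n (nodes n (ascending n xs))"
proof -
  obtain us ws where x: "xs = 1 # us @ n # ws" "sorted_wrt (<) (1 # us @ [n])"
    "sorted_wrt (<) (1 # rev ws @ [n])"
    "set us = {i. 2 \<le> i \<and> i < n \<and> ascending n xs i}"
    "set ws = {i. 2 \<le> i \<and> i < n \<and> \<not> ascending n xs i}"
    using pyr_seqE[OF assms] .
  have E: "tour_edges xs = steps (1 # us @ [n]) \<union> steps (1 # rev ws @ [n])"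
    using steps_append[of "1 # us" n "ws @ [1]"] steps_rev[of "n # ws @ [1]"]
    by (simp add: x(1) tour_edges_steps)
  have iff: "{i, j} \<in> tour_edges xs \<longleftrightarrow> link n (nodes n (ascending n xs)) i j"
    if ij: "1 \<le> i" "i < j" "j \<le> n" for i j
  proof -
    define c where "c = ascending n xs"
    have btw: "k \<in> set (1 # us @ [n]) \<longleftrightarrow> c k" "k \<in> set (1 # rev ws @ [n]) \<longleftrightarrow> \<not> c k"
      if "i < k" "k < j" for k
      using that ij by (auto simp: x(4,5) c_def)
    have 1: "{i, j} \<in> steps (1 # us @ [n]) \<longleftrightarrow>
       (i = 1 \<or> c i) \<and> (j = n \<or> c j) \<and> (\<forall>k. i < k \<and> k < j \<longrightarrow> \<not> c k)"
    proof -
      have "i \<in> set (1 # us @ [n]) \<longleftrightarrow> i = 1 \<or> c i" "j \<in> set (1 # us @ [n]) \<longleftrightarrow> j = n \<or> c j"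
        using ij by (auto simp: x(4) c_def)
      then show ?thesis
        unfolding steps_sorted_wrt[OF x(2) ij(2)] using btw(1) by blast
    qed
    have 2: "{i, j} \<in> steps (1 # rev ws @ [n]) \<longleftrightarrow>
       (i = 1 \<or> \<not> c i) \<and> (j = n \<or> \<not> c j) \<and> (\<forall>k. i < k \<and> k < j \<longrightarrow> c k)"
    proof -
      have "i \<in> set (1 # rev ws @ [n]) \<longleftrightarrow> i = 1 \<or> \<not> c i"
        "j \<in> set (1 # rev ws @ [n]) \<longleftrightarrow> j = n \<or> \<not> c j"
        using ij by (auto simp: x(5) c_def)
      then show ?thesis
        unfolding steps_sorted_wrt[OF x(3) ij(2)] using btw(2) by blast
    qed
    show ?thesis
      unfolding E Un_iff 1 2 c_def[symmetric] link_nodes_iff[OF ij assms(2)] ex_bool_eq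
      by (simp add: disj_commute)
  qed
  have form: "\<exists>i j. e = {i, j} \<and> 1 \<le> i \<and> i < j \<and> j \<le> n" if "e \<in> tour_edges xs" for e
  proof -
    have range: "1 \<le> i" "i \<le> n" if "i \<in> set (1 # us @ [n]) \<or> i \<in> set (1 # rev ws @ [n])" for i
      using that assms(2) by (auto simp: x(4,5))
    from that consider "e \<in> steps (1 # us @ [n])" | "e \<in> steps (1 # rev ws @ [n])"
      unfolding E by blast
    then show ?thesis
      using steps_sorted_wrt_form[OF x(2)] steps_sorted_wrt_form[OF x(3)] range by cases metis+
  qed
  show ?thesis unfolding edges_of_def using iff form by (intro equalityI subsetI) (auto, metis)
qed

lemma pyr_seq_exists:
  assumes "3 \<le> n"
  obtains xs where "pyr_seq n xs" "nodes n (ascending n xs) = nodes n c"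
proof -
  define xs where "xs = 1 # filter c [2..<n] @ n # rev (filter (\<lambda>i. \<not> c i) [2..<n])"
  have "pyr_seq n xs"
    unfolding pyr_seq_def
  proof (intro conjI exI)
    show "xs = 1 # filter c [2..<n] @ n # rev (filter (\<lambda>i. \<not> c i) [2..<n])" by (rule xs_def)
  qed (use assms in \<open>auto simp: xs_def sorted_wrt_filter sorted_wrt_rev\<close>)
  moreover have "takeWhile (\<lambda>v. v \<noteq> n) xs = 1 # filter c [2..<n]"
    using assms by (simp add: xs_def, subst takeWhile_append2) auto
  then have "ascending n xs i = c i" if "2 \<le> i" "i < n" for i
    using that by (auto simp: ascending_def)
  then have "nodes n (ascending n xs) = nodes n c"
    by (auto simp: nodes_def)
  ultimately show thesis using that by blast
qed

lemma pyr_seq_exists_nodes: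
  assumes "3 \<le> n" "2 \<in> N" "n \<in> N" "N \<subseteq> {2..n}"
  obtains xs where "pyr_seq n xs" "nodes n (ascending n xs) = N"
proof -
  \<comment> \<open>The parity of the number of nodes in \<open>{3..k}\<close> flips exactly at the
    nodes from \<open>3\<close> on.\<close>
  define c where "c k = even (card (N \<inter> {3..k}))" for k :: nat
  have "c (k - 1) \<noteq> c k \<longleftrightarrow> k \<in> N" if "3 \<le> k" for k
  proof -
    have "{3..k} = insert k {3..k - 1}" using that by auto
    moreover have "k \<notin> N \<inter> {3..k - 1}" using that by auto
    ultimately show ?thesis by (auto simp: c_def Int_insert_right)
  qed
  note node = this
  have "k \<in> nodes n c \<longleftrightarrow> k \<in> N" for k
  proof -
    consider "k = 2 \<or> k = n" | "3 \<le> k" "k < n" | "k \<notin> {2..n}" by force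
    then show ?thesis
    proof cases
      case 2
      then show ?thesis using node[OF 2(1)] by (simp add: nodes_def)
    next
      case 3
      then show ?thesis using assms(4) by (auto simp: nodes_def)
    qed (use assms in \<open>auto simp: nodes_def\<close>)
  qed
  then have "nodes n c = N" by blast
  then show thesis
    using pyr_seq_exists[OF assms(1), of c] that by metis
qed

section \<open>Adjacency of tours\<close>

lemma charvec_eq_iff: "charvec S = charvec T \<longleftrightarrow> S = T"
proof
  assume *: "charvec S = charvec T"
  have "e \<in> S \<longleftrightarrow> e \<in> T" for e
    using fun_cong[OF *, of e] by (simp add: charvec_def split: if_splits)
  then show "S = T" by blast
qed simp

text \<open>Only the vertices \<open>Suc i, ..., j\<close> are inspected, so a link lying on one
  side of a vertex is unaffected by changes on the other side. The exchange of tails relies on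
  this.\<close>

lemma link_cong:
  assumes "\<And>k. i < k \<Longrightarrow> k \<le> j \<Longrightarrow> k \<in> M \<longleftrightarrow> k \<in> N" "i < j"
  shows "link n M i j \<longleftrightarrow> link n N i j"
  using assms by (auto simp: link_def)

lemma link_mem_iff:
  assumes "3 \<le> k" "k < n"
  shows "link n N (k - Suc 0) k \<longleftrightarrow> k \<notin> N"
  using assms by (auto simp: link_def)

lemma edges_of_mem_iff:
  assumes "1 \<le> i" "i < j" "j \<le> n"
  shows "{i, j} \<in> edges_of n N \<longleftrightarrow> link n N i j"
  using assms by (auto simp: edges_of_def doubleton_eq_iff)

lemma edges_of_Un_link:
  assumes "edges_of n Z \<subseteq> edges_of n X \<union> edges_of n Y" "link n Z i j" "1 \<le> i" "i < j" "j \<le> n"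
  shows "link n X i j \<or> link n Y i j"
proof -
  have "{i, j} \<in> edges_of n Z" using assms by (simp add: edges_of_mem_iff)
  then have "{i, j} \<in> edges_of n X \<or> {i, j} \<in> edges_of n Y" using assms(1) by blast
  then show ?thesis using assms by (simp add: edges_of_mem_iff)
qed

text \<open>A path from \<open>2\<close> to \<open>n\<close> is encoded as the set of vertices it
  visits.\<close>

definition node_sets :: "nat \<Rightarrow> nat set set" where
  "node_sets n = {N. 2 \<in> N \<and> n \<in> N \<and> N \<subseteq> {2..n}}"

lemma nodes_in_node_sets: "3 \<le> n \<Longrightarrow> nodes n c \<in> node_sets n"
  by (auto simp: node_sets_def nodes_def)

lemma PT_eq: "3 \<le> n \<Longrightarrow> PT n = edges_of n ` node_sets n"
proof -
  assume n: "3 \<le> n"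
  show ?thesis
  proof
    show "PT n \<subseteq> edges_of n ` node_sets n"
      unfolding PT_def using n by (auto simp: tour_edges_pyr_seq intro!: imageI nodes_in_node_sets)
    show "edges_of n ` node_sets n \<subseteq> PT n"
    proof (clarify)
      fix N assume "N \<in> node_sets n"
      then obtain xs where "pyr_seq n xs" "nodes n (ascending n xs) = N"
        using pyr_seq_exists_nodes n unfolding node_sets_def by (metis (mono_tags) mem_Collect_eq)
      then show "edges_of n N \<in> PT n"
        unfolding PT_def using tour_edges_pyr_seq n by blast
    qed
  qed
qed

lemma nat_set_pred:
  assumes "x \<in> Z" "x < (q::nat)"
  obtains a where "a \<in> Z" "a < q" "\<And>k. k \<in> Z \<Longrightarrow> k < q \<Longrightarrow> k \<le> a"
proof
  let ?S = "{k \<in> Z. k < q}"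
  have "Max ?S \<in> ?S" using assms by (intro Max_in) auto
  then show "Max ?S \<in> Z" "Max ?S < q" by auto
qed (simp add: Max_ge)

text \<open>Let \<open>p\<close> and \<open>q\<close> be the first places where \<open>Z\<close>
  departs from \<open>X\<close> and from \<open>Y\<close>, say \<open>p < q\<close>. The arc of
  \<open>Z\<close> that passes over \<open>q\<close> or ends there is then an arc of
  \<open>X\<close>, and its start is a common node of \<open>X\<close> and \<open>Y\<close> between
  \<open>p\<close> and \<open>q\<close>, against \<open>sep\<close>.\<close>

lemma edges_of_subset_nodes:
  assumes n: "3 \<le> n" and N: "Z \<in> node_sets n" "X \<in> node_sets n" "Y \<in> node_sets n"
    and sub: "edges_of n Z \<subseteq> edges_of n X \<union> edges_of n Y"
    and sep: "\<nexists>p m q. p < m \<and> m < q \<and> m \<in> X \<and> m \<in> Y \<and> (p \<in> X) \<noteq> (p \<in> Y) \<and> (q \<in> X) \<noteq> (q \<in> Y)"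
  shows "Z = X \<or> Z = Y"
proof (rule ccontr)
  \<comment> \<open>Stated for arbitrary \<open>X\<close> and \<open>Y\<close>, so that it also
    serves the case \<open>q < p\<close> with the roles exchanged.\<close>
  have aux: False
    if N: "Z \<in> node_sets n" "X \<in> node_sets n" "Y \<in> node_sets n"
      and sub: "edges_of n Z \<subseteq> edges_of n X \<union> edges_of n Y"
      and sep: "\<nexists>p m q. p < m \<and> m < q \<and> m \<in> X \<and> m \<in> Y \<and> (p \<in> X) \<noteq> (p \<in> Y) \<and> (q \<in> X) \<noteq> (q \<in> Y)"
      and p: "(p \<in> Z) \<noteq> (p \<in> X)" and q: "(q \<in> Z) \<noteq> (q \<in> Y)"
      and low: "\<And>k. k < q \<Longrightarrow> k \<in> Z \<longleftrightarrow> k \<in> Y" and pq: "p < q" for X Y p q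
  proof -
    have q2: "2 < q" "q < n"
      using q N by (auto simp: node_sets_def subset_iff order.strict_iff_order)
    have "2 \<in> Z" using N by (simp add: node_sets_def)
    then obtain a where a: "a \<in> Z" "a < q" "\<And>k. k \<in> Z \<Longrightarrow> k < q \<Longrightarrow> k \<le> a"
      using nat_set_pred q2(1) by blast
    \<comment> \<open>The arc of \<open>Z\<close> from \<open>a\<close> to \<open>b\<close> is the
      one at \<open>q\<close>; possibly \<open>b = q\<close>.\<close>
    define b where "b = (LEAST k. k \<in> Z \<and> q \<le> k)"
    have "n \<in> Z \<and> q \<le> n" using N q2 by (simp add: node_sets_def)
    then have b: "b \<in> Z" "q \<le> b"
      using LeastI[of "\<lambda>k. k \<in> Z \<and> q \<le> k" n] by (simp_all add: b_def)
    have btw: "k \<notin> Z" if "a < k" "k < b" for k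
      using not_less_Least[of k "\<lambda>k. k \<in> Z \<and> q \<le> k"] a(3)[of k] that by (force simp: b_def)
    have ab: "2 \<le> a" "b \<le> n" using a b N by (auto simp: node_sets_def)
    \<comment> \<open>Having this arc fixes membership on all of \<open>{a..b}\<close>: both ends
      are nodes and nothing in between is.\<close>
    have agree: "k \<in> W \<longleftrightarrow> k \<in> Z" if "link n W (a - 1) b" "a \<le> k" "k \<le> b" for k W
      using that a b ab btw by (cases "k = a"; cases "k = b") (auto simp: link_def split: if_splits)
    have "link n Z (a - 1) b"
      using a b ab btw by (auto simp: link_def)
    then have "link n X (a - 1) b \<or> link n Y (a - 1) b"
      using a b ab by (intro edges_of_Un_link[OF sub]) auto
    moreover have "\<not> link n Y (a - 1) b" using agree[of Y q] q a b by auto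
    ultimately have agX: "k \<in> X \<longleftrightarrow> k \<in> Z" if "a \<le> k" "k \<le> b" for k using agree that by blast
    have "p < a" using agX[of p] p pq b by (cases "p < a") auto
    moreover have "a \<in> X" "a \<in> Y" using agX[of a] a b low by auto
    moreover have "(p \<in> X) \<noteq> (p \<in> Y)" using p low pq by auto
    moreover have "(q \<in> X) \<noteq> (q \<in> Y)" using q agX[of q] a b by auto
    ultimately show False using sep a(2) by blast
  qed
  assume "\<not> (Z = X \<or> Z = Y)"
  then have ex: "\<exists>p. (p \<in> Z) \<noteq> (p \<in> X)" "\<exists>p. (p \<in> Z) \<noteq> (p \<in> Y)" by blast+
  define p where "p = (LEAST p. (p \<in> Z) \<noteq> (p \<in> X))"
  define q where "q = (LEAST p. (p \<in> Z) \<noteq> (p \<in> Y))"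
  have p: "(p \<in> Z) \<noteq> (p \<in> X)" "\<And>k. k < p \<Longrightarrow> k \<in> Z \<longleftrightarrow> k \<in> X"
    unfolding p_def using LeastI_ex[OF ex(1)] not_less_Least by blast+
  have q: "(q \<in> Z) \<noteq> (q \<in> Y)" "\<And>k. k < q \<Longrightarrow> k \<in> Z \<longleftrightarrow> k \<in> Y"
    unfolding q_def using LeastI_ex[OF ex(2)] not_less_Least by blast+
  have "p \<noteq> q"
  proof
    assume "p = q"
    \<comment> \<open>Here \<open>X\<close> and \<open>Y\<close> agree against \<open>Z\<close> at
      \<open>p\<close>. So the arc of \<open>Z\<close> ending at \<open>p\<close>, or the edge
      \<open>{p - 1, p}\<close> if \<open>p\<close> is no node of \<open>Z\<close>, lies in neither
      tour.\<close>
    with p q have pq: "p \<in> X \<longleftrightarrow> p \<in> Y" "p \<in> Z \<longleftrightarrow> p \<notin> X" by auto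
    have b: "2 < p" "p < n"
      using pq N by (auto simp: node_sets_def subset_iff order.strict_iff_order)
    show False
    proof (cases "p \<in> Z")
      case True
      have "2 \<in> Z" using N by (simp add: node_sets_def)
      then obtain a where a: "a \<in> Z" "a < p" "\<And>k. k \<in> Z \<Longrightarrow> k < p \<Longrightarrow> k \<le> a"
        using nat_set_pred b(1) by blast
      have "2 \<le> a" using a N by (auto simp: node_sets_def)
      have "link n Z (a - 1) p" using a True \<open>2 \<le> a\<close> by (fastforce simp: link_def)
      then have "link n X (a - 1) p \<or> link n Y (a - 1) p"
        using a b \<open>2 \<le> a\<close> by (intro edges_of_Un_link[OF sub]) auto
      then show False using True pq \<open>2 \<le> a\<close> a(2) by (auto simp: link_def split: if_splits)
    next
      case False
      then have "link n X (p - 1) p \<or> link n Y (p - 1) p"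
        using b by (intro edges_of_Un_link[OF sub]) (auto simp: link_mem_iff)
      then show False using False pq b by (auto simp: link_mem_iff)
    qed
  qed
  then consider "p < q" | "q < p" by linarith
  then show False
  proof cases
    case 1
    then show False using aux[OF N sub sep p(1) q(1) q(2)] by blast
  next
    case 2
    have "edges_of n Z \<subseteq> edges_of n Y \<union> edges_of n X" using sub by blast
    moreover have "\<nexists>p m q. p < m \<and> m < q \<and> m \<in> Y \<and> m \<in> X \<and> (p \<in> Y) \<noteq> (p \<in> X) \<and> (q \<in> Y) \<noteq> (q \<in> X)"
      using sep by metis
    ultimately show False using aux[OF N(1,3,2) _ _ q(1) p(1) p(2) 2] by blast
  qed
qed

text \<open>For \<open>3 \<le> k\<close> and \<open>k < n\<close>, the edge
  \<open>{k - 1, k}\<close> is present iff \<open>k\<close> is no node, so the edges reveal the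
  nodes.\<close>

lemma edges_of_inj:
  assumes "X \<in> node_sets n" "Y \<in> node_sets n" "edges_of n X = edges_of n Y"
  shows "X = Y"
proof -
  have "k \<in> X \<longleftrightarrow> k \<in> Y" if "3 \<le> k" "k < n" for k
    using that edges_of_Un_link[of n X Y Y "k - 1" k] edges_of_Un_link[of n Y X X "k - 1" k]
    by (simp add: assms(3) link_mem_iff) linarith
  moreover have "k \<in> X \<longleftrightarrow> k \<in> Y" if "\<not> (3 \<le> k \<and> k < n)" for k
  proof -
    have "k = 2 \<or> k = n \<or> k \<notin> {2..n}" using that by auto
    then show ?thesis using assms(1,2) by (auto simp: node_sets_def)
  qed
  ultimately show ?thesis by blast
qed

section \<open>Adjacency in convex hulls of characteristic vectors\<close>

lemma finite_edges_of: "finite (edges_of n N)"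
  by (rule finite_subset[of _ "Pow {1..n}"]) (auto simp: edges_of_def)

lemma finite_node_sets: "finite (node_sets n)"
  by (rule finite_subset[of _ "Pow {2..n}"]) (auto simp: node_sets_def)

lemma sum_charvec: "finite A \<Longrightarrow> (\<Sum>e\<in>A. charvec T e) = real (card (A \<inter> T))"
  by (simp add: charvec_def sum.If_cases Int_def)

text \<open>\<open>f\<close> vanishes at \<open>S\<close> and \<open>T\<close> and is positive at
  every other member. So the affine hull of the two points misses the convex hull of the others, as
  \<open>face_of_convex_hulls\<close> requires.\<close>

lemma adjacent_if_unique_union:
  fixes \<S> :: "nat set set set"
  assumes fin: "finite \<S>" "finite (\<Union>\<S>)" and ST: "S \<in> \<S>" "T \<in> \<S>" "S \<noteq> T"
    and uniq: "\<And>U. U \<in> \<S> \<Longrightarrow> U \<subseteq> S \<union> T \<Longrightarrow> U = S \<or> U = T"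
  shows "adjacent_vertices (convex hull (charvec ` \<S>)) (charvec S) (charvec T)"
proof -
  define A where "A = \<Union>\<S> - (S \<union> T)"
  define f :: "(nat set \<Rightarrow> real) \<Rightarrow> real" where "f x = (\<Sum>e\<in>A. x e)" for x
  have lin: "f (u *\<^sub>R x + v *\<^sub>R y) = u * f x + v * f y" for u v x y
    by (simp add: f_def plus_fun_def scaleR_fun_def sum.distrib sum_distrib_left)
  have finA: "finite A" using fin by (simp add: A_def)
  have f_card: "f (charvec U) = card (A \<inter> U)" for U
    using finA by (simp add: f_def sum_charvec)
  have "affine hull {charvec S, charvec T} \<subseteq> {x. f x = 0}"
  proof (rule hull_minimal)
    have "A \<inter> S = {}" "A \<inter> T = {}" by (auto simp: A_def)
    then show "{charvec S, charvec T} \<subseteq> {x. f x = 0}" by (simp add: f_card)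
  qed (auto simp: affine_def lin)
  moreover have "convex hull (charvec ` \<S> - {charvec S, charvec T}) \<subseteq> {x. 0 < f x}"
  proof (rule hull_minimal)
    show "convex {x. 0 < f x}"
    proof (rule convexI)
      fix x y and u v :: real
      assume *: "x \<in> {x. 0 < f x}" "y \<in> {x. 0 < f x}" "0 \<le> u" "0 \<le> v" "u + v = 1"
      then have "0 < u * f x + v * f y"
        by (cases "u = 0") (auto intro: add_pos_nonneg)
      then show "u *\<^sub>R x + v *\<^sub>R y \<in> {x. 0 < f x}" by (simp add: lin)
    qed
    show "charvec ` \<S> - {charvec S, charvec T} \<subseteq> {x. 0 < f x}"
    proof clarsimp
      fix U assume U: "U \<in> \<S>" "charvec U \<noteq> charvec S" "charvec U \<noteq> charvec T"
      then have "\<not> U \<subseteq> S \<union> T" using uniq by blast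
      then have "A \<inter> U \<noteq> {}" using U(1) by (auto simp: A_def)
      then show "0 < f (charvec U)" using finA by (simp add: f_card card_gt_0_iff)
    qed
  qed
  ultimately have "affine hull {charvec S, charvec T} \<inter>
      convex hull (charvec ` \<S> - {charvec S, charvec T}) = {}"
    by fastforce
  then have "convex hull {charvec S, charvec T} face_of convex hull (charvec ` \<S>)"
    using fin ST by (intro face_of_convex_hulls) auto
  then show ?thesis
    using ST(3) by (simp add: adjacent_vertices_def segment_convex_hull charvec_eq_iff)
qed

text \<open>Both pairs have the same midpoint. A face containing an inner point of a segment
  contains its ends, so \<open>S'\<close> would lie on the segment from \<open>S\<close> to
  \<open>T\<close>, whose only 0/1 vectors are its ends.\<close>

lemma not_adjacent_if_exchange:
  assumes "S' \<in> \<S>" "T' \<in> \<S>" "charvec S' + charvec T' = charvec S + charvec T"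
    and ne: "S' \<noteq> S" "S' \<noteq> T" "S' \<noteq> T'"
  shows "\<not> adjacent_vertices (convex hull (charvec ` \<S>)) (charvec S) (charvec T)"
proof
  assume "adjacent_vertices (convex hull (charvec ` \<S>)) (charvec S) (charvec T)"
  then have face: "closed_segment (charvec S) (charvec T) face_of convex hull (charvec ` \<S>)"
    by (simp add: adjacent_vertices_def)
  define m where "m = midpoint (charvec S) (charvec T)"
  have m: "m = midpoint (charvec S') (charvec T')"
    by (simp add: m_def midpoint_def assms(3))
  have "m \<in> open_segment (charvec S') (charvec T')"
    using ne(3) by (simp add: m charvec_eq_iff)
  moreover have "m \<in> closed_segment (charvec S) (charvec T)"
    by (simp add: m_def)
  moreover have "charvec S' \<in> convex hull (charvec ` \<S>)" "charvec T' \<in> convex hull (charvec ` \<S>)"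
    using assms(1,2) by (auto intro: hull_inc)
  ultimately have "charvec S' \<in> closed_segment (charvec S) (charvec T)"
    using face unfolding face_of_def by blast
  then obtain u where u: "0 \<le> u" "u \<le> 1"
    "charvec S' = (1 - u) *\<^sub>R charvec S + u *\<^sub>R charvec T"
    by (auto simp: closed_segment_def)
  have e: "charvec S' e = (1 - u) * charvec S e + u * charvec T e" for e
    using fun_cong[OF u(3), of e] by (simp add: plus_fun_def scaleR_fun_def)
  have "S' = S \<or> S' = T"
  proof (cases "S = T")
    case True
    have "charvec S' = charvec S"
      using e by (auto simp: fun_eq_iff True algebra_simps)
    then show ?thesis by (simp add: charvec_eq_iff)
  next
    case False
    \<comment> \<open>At this coordinate \<open>S'\<close> has the value \<open>u\<close> or
      \<open>1 - u\<close>, which must be \<open>0\<close> or \<open>1\<close>.\<close>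
    then obtain e0 where "(e0 \<in> S) \<noteq> (e0 \<in> T)" by blast
    then have "u = 0 \<or> u = 1"
      using e[of e0] by (auto simp: charvec_def split: if_splits)
    then show ?thesis using u(3) by (auto simp: charvec_eq_iff)
  qed
  then show False using ne by blast
qed

lemma adjacent_edges_of_iff:
  assumes n: "3 \<le> n" and X: "X \<in> node_sets n" and Y: "Y \<in> node_sets n"
  shows "adjacent_vertices (PYR n) (charvec (edges_of n X)) (charvec (edges_of n Y)) \<longleftrightarrow>
    X \<noteq> Y \<and>
    (\<nexists>p m q. p < m \<and> m < q \<and> m \<in> X \<and> m \<in> Y \<and> (p \<in> X) \<noteq> (p \<in> Y) \<and> (q \<in> X) \<noteq> (q \<in> Y))"
    (is "?adj \<longleftrightarrow> _ \<and> (\<nexists>p m q. ?sep p m q)")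
proof (cases "X = Y")
  case True
  then show ?thesis by (simp add: adjacent_vertices_def)
next
  case False
  have PYR: "PYR n = convex hull (charvec ` edges_of n ` node_sets n)"
    by (simp add: PYR_def PT_eq[OF n])
  show ?thesis
  proof (cases "\<exists>p m q. ?sep p m q")
    case True
    then obtain p m q where s: "?sep p m q" by blast
    define swap where "swap A B = {k \<in> A. k \<le> m} \<union> {k \<in> B. m \<le> k}" for A B :: "nat set"
    have swap: "swap A B \<in> node_sets n" if "A \<in> node_sets n" "B \<in> node_sets n" "m \<in> A" for A B
      using that by (auto simp: swap_def node_sets_def)
    have m: "m \<in> X" "m \<in> Y" using s by auto
    have lo: "k \<in> swap A B \<longleftrightarrow> k \<in> A" if "k \<le> m" "m \<in> A" "m \<in> B" for k A B
      using that by (auto simp: swap_def)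
    have hi: "k \<in> swap A B \<longleftrightarrow> k \<in> B" if "m \<le> k" "m \<in> A" "m \<in> B" for k A B
      using that by (auto simp: swap_def)
    have sum: "charvec (edges_of n (swap X Y)) + charvec (edges_of n (swap Y X)) =
          charvec (edges_of n X) + charvec (edges_of n Y)" (is "?l = ?r")
    proof
      fix e
      show "?l e = ?r e"
      proof (cases "\<exists>i j. 1 \<le> i \<and> i < j \<and> j \<le> n \<and> e = {i, j}")
        case True
        then obtain i j where ij: "1 \<le> i" "i < j" "j \<le> n" "e = {i, j}" by blast
        \<comment> \<open>The inspected vertices \<open>Suc i, ..., j\<close> all lie up to
          \<open>m\<close>, or all lie from \<open>m\<close> on, or have \<open>m\<close> strictly
          inside; in the last case no set containing \<open>m\<close> has the link.\<close>
        consider "j \<le> m" | "m \<le> Suc i" | "Suc i < m" "m < j" by linarith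
        then show ?thesis
        proof cases
          case 1
          then have "link n (swap X Y) i j \<longleftrightarrow> link n X i j" "link n (swap Y X) i j \<longleftrightarrow> link n Y i j"
            using ij m by - (rule link_cong; simp add: lo)+
          then show ?thesis using ij by (simp add: charvec_def edges_of_mem_iff)
        next
          case 2
          then have "link n (swap X Y) i j \<longleftrightarrow> link n Y i j" "link n (swap Y X) i j \<longleftrightarrow> link n X i j"
            using ij m by - (rule link_cong; simp add: hi)+
          then show ?thesis using ij by (simp add: charvec_def edges_of_mem_iff)
        next
          case 3
          then have "\<not> link n A i j" if "m \<in> A" for A
            using that by (auto simp: link_def)
          moreover have "m \<in> swap X Y" "m \<in> swap Y X" using m by (auto simp: swap_def)
          ultimately show ?thesis using ij m by (simp add: charvec_def edges_of_mem_iff)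
        qed
      next
        case False
        then show ?thesis by (auto simp: charvec_def edges_of_def)
      qed
    qed
    \<comment> \<open>The exchanged path is told from \<open>X\<close> at \<open>q\<close> and from
      \<open>Y\<close> at \<open>p\<close>.\<close>
    have "swap X Y \<noteq> X"
      using s hi[of q X Y] by auto
    moreover have "swap X Y \<noteq> Y"
      using s lo[of p X Y] by auto
    moreover have "swap X Y \<noteq> swap Y X"
      using s lo[of p X Y] lo[of p Y X] by auto
    ultimately have ne: "edges_of n (swap X Y) \<noteq> edges_of n X" "edges_of n (swap X Y) \<noteq> edges_of n Y"
      "edges_of n (swap X Y) \<noteq> edges_of n (swap Y X)"
      using edges_of_inj swap X Y m by metis+
    have "\<not> ?adj"
      unfolding PYR using swap X Y m
      by (intro not_adjacent_if_exchange[OF _ _ sum ne] imageI) auto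
    then show ?thesis using True by blast
  next
    case no: False
    have "?adj"
      unfolding PYR
    proof (rule adjacent_if_unique_union)
      show "edges_of n X \<noteq> edges_of n Y" using edges_of_inj X Y False by blast
      fix U assume "U \<in> edges_of n ` node_sets n" "U \<subseteq> edges_of n X \<union> edges_of n Y"
      then show "U = edges_of n X \<or> U = edges_of n Y"
        using edges_of_subset_nodes[OF n _ X Y _ no] by blast
    qed (use X Y in \<open>auto simp: finite_node_sets finite_edges_of\<close>)
    then show ?thesis using False no by blast
  qed
qed

section \<open>The register machine program\<close>

definition effect :: "instr list \<Rightarrow> (nat \<Rightarrow> nat) \<Rightarrow> nat \<Rightarrow> nat" where
  "effect blk m = fold (\<lambda>i m. snd (exec_instr i (0, m))) blk m"

lemma effect_simps:
  "effect [] m = m"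
  "effect (i # blk) m = effect blk (snd (exec_instr i (0, m)))"
  by (simp_all add: effect_def)

fun straight :: "instr \<Rightarrow> bool" where
  "straight (Jz r l) = False"
| "straight (Jmp l) = False"
| "straight Halt = False"
| "straight i = True"

text \<open>The memory effect is independent of the program counter, which justifies fixing the
  counter to \<open>0\<close> in \<open>effect\<close>.\<close>

lemma exec_straight: "straight i \<Longrightarrow> exec_instr i (pc, m) = (Suc pc, snd (exec_instr i (0, m)))"
  by (cases i) auto

lemma run_add: "run p (t + u) c = run p u (run p t c)"
  by (simp add: run_def add.commute[of t u] funpow_add)

lemma run_0: "run p 0 c = c"
  by (simp add: run_def)

lemma run_Suc: "run p (Suc t) c = run p t (step p c)"
  by (simp add: run_def funpow_swap1)

lemma run_1: "run p 1 c = step p c"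
  by (simp add: run_def)

lemma run_append_block:
  assumes "\<forall>i\<in>set blk. straight i"
  shows "run (pre @ blk @ post) (length blk) (length pre, m) = (length pre + length blk, effect blk m)"
  using assms
proof (induction blk arbitrary: pre m)
  case (Cons i blk)
  have "step (pre @ (i # blk) @ post) (length pre, m) = (length (pre @ [i]), snd (exec_instr i (0, m)))"
    using Cons.prems exec_straight[of i "length pre" m] by (auto simp: step_def halted_def)
  then show ?case
    using Cons.IH[of "pre @ [i]" "snd (exec_instr i (0, m))"] Cons.prems by (simp add: run_Suc effect_simps)
qed (simp add: run_0 effect_simps)

lemma run_block:
  assumes "take (length blk) (drop pc p) = blk" "pc \<le> length p" "\<forall>i\<in>set blk. straight i"
  shows "run p (length blk) (pc, m) = (pc + length blk, effect blk m)"
proof -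
  have "p = take pc p @ blk @ drop (length blk) (drop pc p)"
    by (metis assms(1) append_take_drop_id)
  then show ?thesis
    using run_append_block[OF assms(3), of "take pc p" "drop (length blk) (drop pc p)" m] assms(2)
    by simp
qed

text \<open>
  The input occupies every address except \<open>0\<close>, so there is no free register at the start.  The first
  bit \<open>b\<close> is therefore saved as \<open>n + b\<close> at address \<open>8 * n\<close>, which is beyond the input; this also
  preserves \<open>n\<close>, and \<open>recover_block\<close> separates the two by \<open>b = (8 * (n + b) - 8 * n) - 7\<close>.
  The remaining cells are then moved to the addresses from \<open>8 * n\<close> on.  The offset \<open>8 * n \<ge> 24\<close>
  keeps the copy clear of the input and of the work registers \<open>1, \<dots>, 11\<close>.
\<close>

definition init_block :: "instr list" where
  "init_block = [Add 1 0 1, Add 0 0 0, Add 0 0 0, Add 0 0 0, StoreI 0 1, LoadC 1 1]"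

definition save_block :: "instr list" where
  "save_block = concat (map (\<lambda>r. [Add 0 0 1, StoreI 0 r]) [2..<12])"

definition recover_block :: "instr list" where
  "recover_block =
    [LoadC 2 10, Sub 2 0 2, LoadI 6 2, Add 3 6 6, Add 3 3 3, Add 3 3 3, Sub 3 3 2,
     LoadC 4 7, Sub 3 3 4, StoreI 2 3, Sub 6 6 3, Add 4 6 6, LoadC 7 0, Add 7 2 7,
     Add 3 0 1, LoadC 2 12]"

text \<open>Registers 2 and 3 are the source and target pointers, 4 is the counter. Copying
  \<open>2 * n\<close> cells from address \<open>12\<close> on covers the rest of the input for
  every \<open>n \<ge> 3\<close> and keeps the source below \<open>8 * n\<close>.\<close>

definition copy_block :: "instr list" where
  "copy_block = [LoadI 5 2, StoreI 3 5, Add 2 2 1, Add 3 3 1, Sub 4 4 1]"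

text \<open>Registers 2 and 3 point to the copies of the two codes. Registers 5 and 6 start at
  \<open>1\<close> because vertex \<open>2\<close> ascends in both tours. Register 0 serves as zero
  in register moves and as the default answer.\<close>

definition setup_block :: "instr list" where
  "setup_block =
    [LoadC 0 0, Add 2 7 0, LoadC 9 3, Sub 4 6 9, Add 3 2 4, LoadC 5 1, LoadC 6 1,
     LoadC 7 0, LoadC 8 0]"

text \<open>
  During the scan, registers 5 and 6 hold the previous bits of the two codes, register 7 the number
  \<open>s\<close> of alternations and register 8 its parity.  The number \<open>w\<close> of tours having the current vertex as
  a node is computed in register 9; if \<open>w \<noteq> 0\<close>, the new parity is \<open>2 - w\<close>.
\<close>

definition read_block :: "instr list" where
  "read_block =
    [LoadI 9 2, LoadI 10 3, Sub 11 9 5, Sub 5 5 9, Add 11 11 5, Add 5 9 0,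
     Sub 9 10 6, Sub 6 6 10, Add 9 9 6, Add 6 10 0, Add 9 9 11]"

definition update_block :: "instr list" where
  "update_block =
    [LoadC 10 2, Sub 10 10 9, Sub 11 10 8, Sub 9 8 10, Add 7 7 11, Add 7 7 9, Add 8 10 0]"

definition next_block :: "instr list" where
  "next_block = [Add 2 2 1, Add 3 3 1, Sub 4 4 1]"

text \<open>Jump targets are absolute: 42 and 58 are the loop heads, 49 starts the setup, 78
  advances to the next vertex, and the verdict starts at 82.\<close>

definition prog :: "instr list" where
  "prog = init_block @ save_block @ recover_block @
     [Jz 4 49] @ copy_block @ [Jmp 42] @
     setup_block @
     [Jz 4 82] @ read_block @ [Jz 9 78] @ update_block @ next_block @ [Jmp 58] @
     [Jz 7 88, LoadC 9 2, Sub 7 7 9, Jz 7 87, Halt, LoadC 0 1, Halt]"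

lemmas block_defs = init_block_def save_block_def recover_block_def copy_block_def
  setup_block_def read_block_def update_block_def next_block_def

lemma length_prog: "length prog = 89"
  by (simp add: prog_def block_defs)

lemma run_prog_block:
  assumes "take (length blk) (drop pc prog) = blk" "\<forall>i\<in>set blk. straight i"
    "length blk = t" "pc + t = pc'" "pc \<le> 89"
  shows "run prog t (pc, m) = (pc', effect blk m)"
  using run_block[of blk pc prog m] assms by (simp add: length_prog)

lemma run_prog_blocks:
  "run prog 6 (0, m) = (6, effect init_block m)"
  "run prog 20 (6, m) = (26, effect save_block m)"
  "run prog 16 (26, m) = (42, effect recover_block m)"
  "run prog 5 (43, m) = (48, effect copy_block m)"
  "run prog 9 (49, m) = (58, effect setup_block m)"
  "run prog 11 (59, m) = (70, effect read_block m)"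
  "run prog 7 (71, m) = (78, effect update_block m)"
  "run prog 3 (78, m) = (81, effect next_block m)"
  by (rule run_prog_block; simp add: prog_def block_defs)+

lemma step_prog: "i < 89 \<Longrightarrow> step prog (i, m) = exec_instr (prog ! i) (i, m)"
  by (auto simp: step_def halted_def length_prog)

lemma prog_nth:
  "prog ! 42 = Jz 4 49" "prog ! 48 = Jmp 42" "prog ! 58 = Jz 4 82" "prog ! 70 = Jz 9 78"
  "prog ! 81 = Jmp 58" "prog ! 82 = Jz 7 88" "prog ! 83 = LoadC 9 2" "prog ! 84 = Sub 7 7 9"
  "prog ! 85 = Jz 7 87" "prog ! 86 = Halt" "prog ! 87 = LoadC 0 1" "prog ! 88 = Halt"
  by (simp_all add: prog_def block_defs)

section \<open>Memory effect of the blocks\<close>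

lemma effect_init_block:
  assumes "m 0 = n" "3 \<le> n"
  shows "effect init_block m = m(0 := 8 * n, 1 := 1, 8 * n := n + m 1)"
  using assms by (simp add: effect_simps init_block_def fun_eq_iff)

lemma effect_save_block:
  assumes "m 0 = d" "m 1 = 1" "24 \<le> d"
  shows "effect save_block m 0 = d + 10" "effect save_block m 1 = 1"
    "\<And>a. 1 \<le> a \<Longrightarrow> a \<le> 10 \<Longrightarrow> effect save_block m (d + a) = m (Suc a)"
    "\<And>a. 1 \<le> a \<Longrightarrow> a \<le> d \<Longrightarrow> effect save_block m a = m a"
proof -
  have eq: "effect save_block m = m(0 := d + 10, d + 1 := m 2, d + 2 := m 3, d + 3 := m 4,
      d + 4 := m 5, d + 5 := m 6, d + 6 := m 7, d + 7 := m 8, d + 8 := m 9, d + 9 := m 10,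
      d + 10 := m 11)" (is "_ = ?m'")
    using assms by (simp add: effect_simps save_block_def fun_eq_iff)
  show "effect save_block m 0 = d + 10" "effect save_block m 1 = 1"
    using assms by (simp_all add: eq)
  show "effect save_block m (d + a) = m (Suc a)" if "1 \<le> a" "a \<le> 10" for a
  proof -
    have "a = 1 \<or> a = 2 \<or> a = 3 \<or> a = 4 \<or> a = 5 \<or> a = 6 \<or> a = 7 \<or> a = 8 \<or> a = 9 \<or> a = 10"
      using that by presburger
    then show ?thesis by (elim disjE) (simp_all add: eq assms flip: numeral_2_eq_2)
  qed
  show "effect save_block m a = m a" if "1 \<le> a" "a \<le> d" for a
    using that by (simp add: eq)
qed

text \<open>The two values of \<open>b\<close> are computed separately, because the truncated
  difference \<open>8 * b - 7\<close> equals \<open>b\<close> only for bits.\<close>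

lemma effect_recover_block:
  assumes "m 0 = d + 10" "m 1 = 1" "m d = n + b" "d = 8 * n" "b \<le> 1" "3 \<le> n"
  defines "m' \<equiv> effect recover_block m"
  shows "m' 1 = 1" "m' 2 = 12" "m' 3 = d + 11" "m' 4 = 2 * n" "m' 6 = n" "m' 7 = d" "m' d = b"
    "\<And>a. 12 \<le> a \<Longrightarrow> a \<noteq> d \<Longrightarrow> m' a = m a"
proof -
  have b: "b = 0 \<or> b = 1" using assms(5) by auto
  have eq: "m' = m(2 := 12, 6 := n, 3 := d + 11, 4 := 2 * n, d := b, 7 := d)"
    using b
  proof
    assume "b = 0"
    then show ?thesis
      using assms(1-4,6) by (simp add: m'_def effect_simps recover_block_def fun_eq_iff)
  next
    assume "b = 1"
    then show ?thesis
      using assms(1-4,6) by (simp add: m'_def effect_simps recover_block_def fun_eq_iff)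
  qed
  show "m' 1 = 1" "m' 2 = 12" "m' 3 = d + 11" "m' 4 = 2 * n" "m' 6 = n" "m' 7 = d" "m' d = b"
    "\<And>a. 12 \<le> a \<Longrightarrow> a \<noteq> d \<Longrightarrow> m' a = m a"
    using assms(1-6) by (simp_all add: eq)
qed

lemma effect_copy_block:
  assumes "m 1 = 1" "12 \<le> m 2" "12 \<le> m 3"
  shows "effect copy_block m = m(2 := m 2 + 1, 3 := m 3 + 1, 4 := m 4 - 1, 5 := m (m 2), m 3 := m (m 2))"
  using assms by (simp add: effect_simps copy_block_def fun_eq_iff)

lemma effect_setup_block:
  "effect setup_block m =
     m(0 := 0, 2 := m 7, 3 := m 7 + (m 6 - 3), 4 := m 6 - 3, 5 := 1, 6 := 1, 7 := 0, 8 := 0, 9 := 3)"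
  by (simp add: effect_simps setup_block_def fun_eq_iff)

lemma effect_read_block:
  assumes "m 0 = 0" "12 \<le> m 3" "m (m 2) = x" "m (m 3) = y"
  shows "effect read_block m = m(5 := x, 6 := y, 10 := y, 11 := (x - m 5) + (m 5 - x),
    9 := (y - m 6) + (m 6 - y) + ((x - m 5) + (m 5 - x)))"
  using assms by (simp add: effect_simps read_block_def fun_eq_iff)

lemma effect_update_block:
  assumes "m 0 = 0"
  shows "effect update_block m = m(8 := 2 - m 9, 10 := 2 - m 9, 11 := (2 - m 9) - m 8,
    9 := m 8 - (2 - m 9), 7 := m 7 + ((2 - m 9) - m 8) + (m 8 - (2 - m 9)))"
  using assms by (simp add: effect_simps update_block_def fun_eq_iff)

lemma effect_next_block:
  assumes "m 1 = 1"
  shows "effect next_block m = m(2 := m 2 + 1, 3 := m 3 + 1, 4 := m 4 - 1)"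
  using assms by (simp add: effect_simps next_block_def fun_eq_iff)

lemma run_copy_iteration:
  assumes "m 4 \<noteq> 0"
  shows "run prog 7 (42, m) = (42, effect copy_block m)"
proof -
  have "run prog (1 + (5 + 1)) (42, m) = (42, effect copy_block m)"
    unfolding run_add run_1 using assms by (simp add: step_prog prog_nth run_prog_blocks)
  then show ?thesis by simp
qed

text \<open>\<open>g\<close> is the original memory, whose cell \<open>Suc a\<close> moves to
  \<open>8 * n + a\<close>. Eleven cells are in place before the loop, hence the offsets
  \<open>11\<close> and \<open>12\<close>. An iteration takes seven steps, and the final jump
  one.\<close>

lemma run_copy_loop:
  assumes "3 \<le> n" "i + k = 2 * n"
    and "m 1 = 1" "m 2 = 12 + i" "m 3 = 8 * n + 11 + i" "m 4 = k" "m 6 = n" "m 7 = 8 * n"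
    and "\<And>a. 12 \<le> a \<Longrightarrow> a < 8 * n \<Longrightarrow> m a = g a"
    and "\<And>a. a < 11 + i \<Longrightarrow> m (8 * n + a) = g (Suc a)"
  shows "\<exists>m'. run prog (7 * k + 1) (42, m) = (49, m') \<and> m' 1 = 1 \<and> m' 6 = n \<and> m' 7 = 8 * n \<and>
    (\<forall>a < 11 + 2 * n. m' (8 * n + a) = g (Suc a))"
  using assms
proof (induction k arbitrary: i m)
  case 0
  then show ?case
    by (intro exI[of _ m]) (simp add: run_1 step_prog prog_nth del: One_nat_def)
next
  case (Suc k)
  let ?m = "effect copy_block m"
  have eq: "?m = m(2 := 12 + Suc i, 3 := 8 * n + 11 + Suc i, 4 := k, 5 := g (12 + i), 8 * n + 11 + i := g (12 + i))"
    using Suc.prems by (subst effect_copy_block) (simp_all add: fun_eq_iff)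
  have "\<exists>m'. run prog (7 * k + 1) (42, ?m) = (49, m') \<and> m' 1 = 1 \<and> m' 6 = n \<and> m' 7 = 8 * n \<and>
    (\<forall>a < 11 + 2 * n. m' (8 * n + a) = g (Suc a))"
  proof (rule Suc.IH[of "Suc i"])
    show "?m (8 * n + a) = g (Suc a)" if "a < 11 + Suc i" for a
    proof (cases "a = 11 + i")
      case False
      then have "m (8 * n + a) = g (Suc a)" using Suc.prems(10)[of a] that by simp
      then show ?thesis using False that Suc.prems(1) by (simp add: eq)
    qed (use Suc.prems(1) in \<open>simp add: eq\<close>)
  qed (use Suc.prems in \<open>simp_all add: eq\<close>)
  moreover have "run prog (7 * Suc k + 1) (42, m) = run prog (7 * k + 1) (42, ?m)"
  proof -
    have "7 * Suc k + 1 = 7 + (7 * k + 1)" by simp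
    then show ?thesis
      using Suc.prems(6) by (simp only: run_add[of prog 7]) (simp add: run_copy_iteration)
  qed
  ultimately show ?case by simp
qed

section \<open>Counting alternations of exclusive and common nodes\<close>

definition differs :: "nat set \<Rightarrow> nat set \<Rightarrow> nat \<Rightarrow> bool" where
  "differs X Y k \<longleftrightarrow> (\<exists>p\<le>k. (p \<in> X) \<noteq> (p \<in> Y))"

definition differs_meets :: "nat set \<Rightarrow> nat set \<Rightarrow> nat \<Rightarrow> bool" where
  "differs_meets X Y k \<longleftrightarrow> (\<exists>m\<le>k. (\<exists>p<m. (p \<in> X) \<noteq> (p \<in> Y)) \<and> m \<in> X \<and> m \<in> Y)"

text \<open>Up to the bound \<open>k\<close>, this is the obstruction to adjacency in
  \<open>adjacent_edges_of_iff\<close>.\<close>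

definition differs_twice :: "nat set \<Rightarrow> nat set \<Rightarrow> nat \<Rightarrow> bool" where
  "differs_twice X Y k \<longleftrightarrow>
    (\<exists>q\<le>k. (\<exists>m<q. (\<exists>p<m. (p \<in> X) \<noteq> (p \<in> Y)) \<and> m \<in> X \<and> m \<in> Y) \<and> (q \<in> X) \<noteq> (q \<in> Y))"

lemma ex_le_Suc: "(\<exists>m\<le>Suc k. P m) \<longleftrightarrow> (\<exists>m\<le>k. P m) \<or> P (Suc k)"
  by (auto simp: le_Suc_eq)

lemma differs_Suc:
  "differs X Y (Suc k) \<longleftrightarrow> differs X Y k \<or> (Suc k \<in> X) \<noteq> (Suc k \<in> Y)"
  unfolding differs_def ex_le_Suc ..

lemma differs_meets_Suc:
  "differs_meets X Y (Suc k) \<longleftrightarrow> differs_meets X Y k \<or> differs X Y k \<and> Suc k \<in> X \<and> Suc k \<in> Y"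
  unfolding differs_meets_def differs_def ex_le_Suc less_Suc_eq_le ..

lemma differs_twice_Suc:
  "differs_twice X Y (Suc k) \<longleftrightarrow>
     differs_twice X Y k \<or> differs_meets X Y k \<and> (Suc k \<in> X) \<noteq> (Suc k \<in> Y)"
  unfolding differs_twice_def differs_meets_def ex_le_Suc less_Suc_eq_le ..

text \<open>Only whether \<open>s\<close> is \<open>0\<close>, \<open>1\<close>, \<open>2\<close> or larger matters, so larger counts are not specified.\<close>

definition alternation :: "nat set \<Rightarrow> nat set \<Rightarrow> nat \<Rightarrow> nat \<Rightarrow> bool" where
  "alternation X Y k s \<longleftrightarrow>
    (1 \<le> s \<longleftrightarrow> differs X Y k) \<and> (2 \<le> s \<longleftrightarrow> differs_meets X Y k) \<and> (3 \<le> s \<longleftrightarrow> differs_twice X Y k)"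

lemma bit_True_False [simp]: "bit True = 1" "bit False = 0"
  by (simp_all add: bit_def)

text \<open>The update adds \<open>1\<close> exactly when the parity has to change. An exclusive
  node makes \<open>s\<close> odd and a common node makes it even, so repetitions of one kind leave
  \<open>s\<close> unchanged, and so do common nodes met while \<open>s = 0\<close>.\<close>

lemma alternation_Suc:
  fixes X Y :: "nat set" and k s :: nat
  defines "w \<equiv> bit (Suc k \<in> X) + bit (Suc k \<in> Y)"
  assumes "alternation X Y k s"
  shows "w = 0 \<Longrightarrow> alternation X Y (Suc k) s"
    and "w \<noteq> 0 \<Longrightarrow> alternation X Y (Suc k) (s + ((2 - w) - s mod 2) + (s mod 2 - (2 - w)))"
    and "w \<noteq> 0 \<Longrightarrow> (s + ((2 - w) - s mod 2) + (s mod 2 - (2 - w))) mod 2 = 2 - w"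
proof -
  \<comment> \<open>Parity separates the stages: below \<open>3\<close>, an odd \<open>s\<close> is
    \<open>1\<close> and an even one is \<open>0\<close> or \<open>2\<close>.\<close>
  have odd: "s = 1 \<or> 3 \<le> s" if "s mod 2 = 1" using that by presburger
  have even: "s = 0 \<or> 2 \<le> s" "s \<noteq> 1" if "s mod 2 = 0" using that by presburger+
  have par: "s mod 2 = 0 \<or> s mod 2 = 1" by presburger
  consider (0) "w = 0" "Suc k \<notin> X" "Suc k \<notin> Y" | (1) "w = 1" "(Suc k \<in> X) \<noteq> (Suc k \<in> Y)"
    | (2) "w = 2" "Suc k \<in> X" "Suc k \<in> Y"
    by (cases "Suc k \<in> X"; cases "Suc k \<in> Y") (simp_all add: w_def)
  note w_cases = this
  show "alternation X Y (Suc k) s" if "w = 0"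
    using w_cases by cases
      (use assms(2) that in \<open>auto simp: alternation_def differs_Suc differs_meets_Suc differs_twice_Suc\<close>)
  show "alternation X Y (Suc k) (s + ((2 - w) - s mod 2) + (s mod 2 - (2 - w)))" if "w \<noteq> 0"
    using w_cases
  proof cases
    case 1
    then show ?thesis
      using assms(2) par odd even
      unfolding alternation_def differs_Suc differs_meets_Suc differs_twice_Suc
      by (elim disjE) auto
  next
    case 2
    then show ?thesis
      using assms(2) par odd even
      unfolding alternation_def differs_Suc differs_meets_Suc differs_twice_Suc
      by (elim disjE) auto
  qed (use that in simp)
  show "(s + ((2 - w) - s mod 2) + (s mod 2 - (2 - w))) mod 2 = 2 - w" if "w \<noteq> 0"
    using w_cases
  proof cases
    case 1
    then show ?thesis using par by (elim disjE) (simp_all, presburger)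
  next
    case 2
    then show ?thesis using par by (elim disjE) (simp_all, presburger)
  qed (use that in simp)
qed

text \<open>The state at the loop head after \<open>i\<close> iterations; the last vertex processed
  is \<open>2 + i\<close>.\<close>

definition scan_inv ::
  "nat \<Rightarrow> (nat \<Rightarrow> bool) \<Rightarrow> (nat \<Rightarrow> bool) \<Rightarrow> nat set \<Rightarrow> nat set \<Rightarrow> nat \<Rightarrow> (nat \<Rightarrow> nat) \<Rightarrow> bool" where
  "scan_inv n c d X Y i m \<longleftrightarrow>
    m 0 = 0 \<and> m 1 = 1 \<and> m 2 = 8 * n + i \<and> m 3 = 8 * n + (n - 3) + i \<and> m 4 = n - 3 - i \<and>
    m 5 = bit (c (2 + i)) \<and> m 6 = bit (d (2 + i)) \<and> m 8 = m 7 mod 2 \<and>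
    alternation X Y (2 + i) (m 7) \<and>
    (\<forall>k < n - 3. m (8 * n + k) = bit (c (3 + k)) \<and> m (8 * n + (n - 3) + k) = bit (d (3 + k)))"

text \<open>This exclusive or, written with truncated subtraction, is how \<open>read_block\<close>
  recognises a node.\<close>

lemma bit_diff_diff: "(bit a - bit b) + (bit b - bit a) = bit (b \<noteq> a)"
  by (cases a; cases b) simp_all

text \<open>An iteration takes 24 steps, or 17 if the vertex is a node of neither tour and the
  update is skipped.\<close>

lemma run_scan_iteration:
  assumes inv: "scan_inv n c d X Y i m" and n: "3 \<le> n" and i: "i < n - 3"
    and X: "\<And>k. 3 \<le> k \<Longrightarrow> k < n \<Longrightarrow> k \<in> X \<longleftrightarrow> c (k - 1) \<noteq> c k"
    and Y: "\<And>k. 3 \<le> k \<Longrightarrow> k < n \<Longrightarrow> k \<in> Y \<longleftrightarrow> d (k - 1) \<noteq> d k"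
  obtains t m' where "t \<le> 24" "run prog t (58, m) = (58, m')" "scan_inv n c d X Y (Suc i) m'"
proof -
  define x y where "x = c (3 + i)" and "y = d (3 + i)"
  have m: "m 0 = 0" "m 1 = 1" "m 2 = 8 * n + i" "m 3 = 8 * n + (n - 3) + i" "m 4 = n - 3 - i"
    "m 5 = bit (c (2 + i))" "m 6 = bit (d (2 + i))" "m 8 = m 7 mod 2"
    "m (8 * n + i) = bit x" "m (8 * n + (n - 3) + i) = bit y"
    and alt: "alternation X Y (2 + i) (m 7)"
    and data: "\<And>k. k < n - 3 \<Longrightarrow> m (8 * n + k) = bit (c (3 + k))"
      "\<And>k. k < n - 3 \<Longrightarrow> m (8 * n + (n - 3) + k) = bit (d (3 + k))"
    using inv i by (simp_all add: scan_inv_def x_def y_def)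
  have XY: "bit (c (2 + i) \<noteq> x) = bit (Suc (2 + i) \<in> X)" "bit (d (2 + i) \<noteq> y) = bit (Suc (2 + i) \<in> Y)"
    using X[of "3 + i"] Y[of "3 + i"] i by (simp_all add: x_def y_def numeral_3_eq_3)
  have xy: "c (2 + Suc i) = x" "d (2 + Suc i) = y"
    by (simp_all add: x_def y_def numeral_3_eq_3)
  define w where "w = bit (Suc (2 + i) \<in> X) + bit (Suc (2 + i) \<in> Y)"
  define m1 where "m1 = effect read_block m"
  have m1: "m1 = m(5 := bit x, 6 := bit y, 10 := bit y, 11 := bit (Suc (2 + i) \<in> X), 9 := w)"
    unfolding m1_def
    by (subst effect_read_block[of m "bit x" "bit y"])
      (use m n XY in \<open>simp_all add: bit_diff_diff w_def add.commute\<close>)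
  have run1: "run prog (12 + t) (58, m) = run prog t (70, m1)" for t
  proof -
    have "m 4 \<noteq> 0" using m(5) i by simp
    then have "run prog (1 + (11 + t)) (58, m) = run prog t (70, m1)"
      unfolding run_add run_1 by (simp add: step_prog prog_nth run_prog_blocks m1_def)
    then show ?thesis by (simp add: add.commute)
  qed
  have run2: "run prog 4 (78, m') = (58, effect next_block m')" for m'
  proof -
    have "run prog (3 + 1) (78, m') = (58, effect next_block m')"
      unfolding run_add run_1 by (simp add: step_prog prog_nth run_prog_blocks)
    then show ?thesis by simp
  qed
  show thesis
  proof (cases "w = 0")
    case True
    show thesis
    proof (rule that)
      have "run prog (12 + (1 + 4)) (58, m) = (58, effect next_block m1)"
        unfolding run1 unfolding run_add run_1 using True
        by (simp add: step_prog prog_nth run2) (simp add: m1)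
      then show "run prog 17 (58, m) = (58, effect next_block m1)" by simp
      have "m1 1 = 1" using m by (simp add: m1)
      note eq = effect_next_block[of m1, OF this]
      have "alternation X Y (2 + Suc i) (m 7)"
        using alternation_Suc(1)[OF alt] True by (simp add: w_def)
      then show "scan_inv n c d X Y (Suc i) (effect next_block m1)"
        unfolding scan_inv_def xy eq unfolding m1 using n i m data by simp
    qed simp
  next
    case False
    define m2 where "m2 = effect update_block m1"
    have "m1 0 = 0" by (simp add: m1 m)
    note eq2 = effect_update_block[of m1, OF this, folded m2_def]
    show thesis
    proof (rule that)
      have "run prog (12 + (1 + (7 + 4))) (58, m) = (58, effect next_block m2)"
        unfolding run1 unfolding run_add run_1 using False
        by (simp add: step_prog prog_nth m1) (simp add: run_prog_blocks run2 m2_def m1)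
      then show "run prog 24 (58, m) = (58, effect next_block m2)" by simp
      have "m2 1 = 1" using m by (simp add: m1 eq2)
      note eq = effect_next_block[of m2, OF this]
      have vals: "m2 0 = 0" "m2 2 = 8 * n + i" "m2 3 = 8 * n + (n - 3) + i" "m2 4 = n - 3 - i"
        "m2 5 = bit x" "m2 6 = bit y"
        unfolding eq2 m1 using m by simp_all
      have high: "m2 a = m a" if "12 \<le> a" for a
        unfolding eq2 m1 using that by simp
      have mem: "m2 (8 * n + k) = bit (c (3 + k))" "m2 (8 * n + (n - 3) + k) = bit (d (3 + k))"
        if "k < n - 3" for k
        using data[OF that] n high by simp_all
      have "alternation X Y (2 + Suc i) (m2 7)" "m2 7 mod 2 = m2 8"
        using alternation_Suc(2,3)[OF alt] False
        by (simp_all add: w_def eq2 m1 m(8) del: One_nat_def)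
      then show "scan_inv n c d X Y (Suc i) (effect next_block m2)"
        unfolding scan_inv_def xy eq using vals \<open>m2 1 = 1\<close> i n mem by simp
    qed simp
  qed
qed

lemma run_scan_loop:
  assumes "scan_inv n c d X Y i m" "3 \<le> n" "i + k = n - 3"
    and "\<And>k. 3 \<le> k \<Longrightarrow> k < n \<Longrightarrow> k \<in> X \<longleftrightarrow> c (k - 1) \<noteq> c k"
    and "\<And>k. 3 \<le> k \<Longrightarrow> k < n \<Longrightarrow> k \<in> Y \<longleftrightarrow> d (k - 1) \<noteq> d k"
  shows "\<exists>t m'. t \<le> 24 * k \<and> run prog t (58, m) = (58, m') \<and> scan_inv n c d X Y (n - 3) m'"
  using assms(1,3)
proof (induction k arbitrary: i m)
  case 0
  then show ?case by (intro exI[of _ 0] exI[of _ m]) (simp add: run_0)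
next
  case (Suc k)
  then have "i < n - 3" by simp
  then obtain t m1 where 1: "t \<le> 24" "run prog t (58, m) = (58, m1)" "scan_inv n c d X Y (Suc i) m1"
    using run_scan_iteration[OF Suc.prems(1) assms(2) _ assms(4,5)] by metis
  obtain u m' where 2: "u \<le> 24 * k" "run prog u (58, m1) = (58, m')" "scan_inv n c d X Y (n - 3) m'"
    using Suc.IH[OF 1(3)] Suc.prems(2) by auto
  have "run prog (t + u) (58, m) = (58, m')" by (simp add: run_add 1 2)
  moreover have "t + u \<le> 24 * Suc k" using 1 2 by simp
  ultimately show ?case using 2(3) by blast
qed

text \<open>Once the count \<open>0\<close> is rejected, the truncated difference of the count and
  \<open>2\<close> is zero exactly for \<open>1\<close> and \<open>2\<close>.\<close>

lemma run_verdict: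
  assumes "m 0 = 0" "m 4 = 0"
  obtains t where "t \<le> 6" "halted prog (run prog t (58, m))"
    "snd (run prog t (58, m)) 0 = bit (m 7 = 1 \<or> m 7 = 2)"
proof -
  let ?m = "m(9 := 2, 7 := m 7 - 2)"
  have go: "run prog (Suc (Suc t)) (58, m) = (if m 7 = 0 then run prog t (88, m) else run prog t (83, m))" for t
    using assms by (simp add: run_Suc step_prog prog_nth)
  have go2: "run prog (Suc (Suc (Suc t))) (83, m) = (if m 7 \<le> 2 then run prog t (87, ?m) else run prog t (86, ?m))" for t
    by (simp add: run_Suc step_prog prog_nth)
  have go3: "run prog (Suc 0) (87, m') = (88, m'(0 := 1))" for m'
    by (simp add: run_0 run_Suc step_prog prog_nth)
  have h: "halted prog (88, m')" "halted prog (86, m')" for m'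
    by (simp_all add: halted_def prog_nth)
  consider "m 7 = 0" | "m 7 = 1 \<or> m 7 = 2" | "2 < m 7" by linarith
  then show thesis
  proof cases
    case 1
    then show thesis using assms by (intro that[of 2]) (simp_all add: numeral_2_eq_2 go run_0 h)
  next
    case 2
    then have "run prog (Suc (Suc (Suc (Suc (Suc (Suc 0)))))) (58, m) = (88, ?m(0 := 1))"
      unfolding go by (auto simp only: go2 go3) simp_all
    then show thesis using 2 by (intro that[of "Suc (Suc (Suc (Suc (Suc (Suc 0)))))"]) (simp_all only: h, auto)
  next
    case 3
    then have "run prog (Suc (Suc (Suc (Suc (Suc 0))))) (58, m) = (86, ?m)"
      unfolding go by (simp add: go2 run_0)
    then show thesis using 3 assms by (intro that[of "Suc (Suc (Suc (Suc (Suc 0))))"]) (simp_all only: h, auto)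
  qed
qed

lemma alternation_verdict:
  assumes "alternation X Y (n - 1) s" "\<And>p. n \<le> p \<Longrightarrow> p \<in> X \<longleftrightarrow> p \<in> Y"
  shows "s = 1 \<or> s = 2 \<longleftrightarrow> X \<noteq> Y \<and>
    (\<nexists>p m q. p < m \<and> m < q \<and> m \<in> X \<and> m \<in> Y \<and> (p \<in> X) \<noteq> (p \<in> Y) \<and> (q \<in> X) \<noteq> (q \<in> Y))"
proof -
  have le: "p \<le> n - 1" if "(p \<in> X) \<noteq> (p \<in> Y)" for p
    using assms(2)[of p] that by linarith
  have "1 \<le> s \<longleftrightarrow> X \<noteq> Y"
    using assms(1) le unfolding alternation_def differs_def by blast
  moreover have "3 \<le> s \<longleftrightarrow> (\<exists>p m q. p < m \<and> m < q \<and> m \<in> X \<and> m \<in> Y \<and>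
      (p \<in> X) \<noteq> (p \<in> Y) \<and> (q \<in> X) \<noteq> (q \<in> Y))"
    using assms(1) le unfolding alternation_def differs_twice_def by blast
  moreover have "s = 1 \<or> s = 2 \<longleftrightarrow> 1 \<le> s \<and> \<not> 3 \<le> s" by linarith
  ultimately show ?thesis by simp
qed

section \<open>Correctness of the whole program\<close>

lemma prog_prepares_scan:
  assumes n: "3 \<le> n" and m: "m 0 = n" "m 1 \<le> 1"
    and data: "\<And>k. k < n - 3 \<Longrightarrow> m (Suc k) = bit (c (3 + k))"
      "\<And>k. k < n - 3 \<Longrightarrow> m (Suc (n - 3 + k)) = bit (d (3 + k))"
    and cd: "c 2" "d 2" and alt: "alternation X Y 2 0"
  obtains m' where "run prog (14 * n + 52) (0, m) = (58, m')" "scan_inv n c d X Y 0 m'"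
proof -
  define m1 where "m1 = effect init_block m"
  define m2 where "m2 = effect save_block m1"
  define m3 where "m3 = effect recover_block m2"
  have m1: "m1 = m(0 := 8 * n, 1 := 1, 8 * n := n + m 1)"
    unfolding m1_def using effect_init_block m(1) n .
  have "m1 0 = 8 * n" "m1 1 = 1" "24 \<le> 8 * n" using n by (simp_all add: m1)
  note m2 = effect_save_block[of m1, OF this, folded m2_def]
  have "m2 (8 * n) = n + m 1" using m2(4)[of "8 * n"] n by (simp add: m1)
  note m3 = effect_recover_block[OF m2(1,2) this refl m(2) n, folded m3_def]
  have "m3 (8 * n + a) = m (Suc a)" if "a < 11" for a
  proof (cases "a = 0")
    case True
    then show ?thesis using m3(7) by simp
  next
    case False
    then have "m3 (8 * n + a) = m1 (Suc a)"
      using m3(8)[of "8 * n + a"] m2(3)[of a] that n by simp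
    also have "\<dots> = m (Suc a)" using that n False by (simp add: m1)
    finally show ?thesis .
  qed
  moreover have "m3 a = m a" if "12 \<le> a" "a < 8 * n" for a
  proof -
    have "m3 a = m1 a" using m3(8)[of a] m2(4)[of a] that by simp
    then show ?thesis using that by (simp add: m1)
  qed
  ultimately obtain m4 where run4: "run prog (7 * (2 * n) + 1) (42, m3) = (49, m4)"
    and m4: "m4 1 = 1" "m4 6 = n" "m4 7 = 8 * n" "\<And>a. a < 11 + 2 * n \<Longrightarrow> m4 (8 * n + a) = m (Suc a)"
    using run_copy_loop[of n 0 "2 * n" m3 m] n m3 by auto
  define m5 where "m5 = effect setup_block m4"
  have m5: "m5 0 = 0" "m5 1 = 1" "m5 2 = 8 * n" "m5 3 = 8 * n + (n - 3)" "m5 4 = n - 3"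
    "m5 5 = 1" "m5 6 = 1" "m5 7 = 0" "m5 8 = 0" "\<And>a. 12 \<le> a \<Longrightarrow> m5 a = m4 a"
    unfolding m5_def effect_setup_block using m4 by simp_all
  show thesis
  proof (rule that)
    \<comment> \<open>Kept folded so that \<open>run_add\<close> splits the time at the block
      boundaries only.\<close>
    define T where "T = 7 * (2 * n) + 1"
    have "run prog (6 + (20 + (16 + (T + 9)))) (0, m) = (58, m5)"
      unfolding run_add by (simp only: run_prog_blocks run4[folded T_def] m1_def[symmetric]
          m2_def[symmetric] m3_def[symmetric] m5_def[symmetric])
    moreover have "6 + (20 + (16 + (T + 9))) = 14 * n + 52" by (simp add: T_def)
    ultimately show "run prog (14 * n + 52) (0, m) = (58, m5)" by (simp only:)
    have "m5 (8 * n + k) = bit (c (3 + k))" "m5 (8 * n + (n - 3) + k) = bit (d (3 + k))"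
      if "k < n - 3" for k
    proof -
      show "m5 (8 * n + k) = bit (c (3 + k))"
        using m5(10)[of "8 * n + k"] m4(4)[of k] data(1)[of k] that n by simp
      have "m5 (8 * n + (n - 3 + k)) = m (Suc (n - 3 + k))"
        using m5(10)[of "8 * n + (n - 3 + k)"] m4(4)[of "n - 3 + k"] that n by simp
      then show "m5 (8 * n + (n - 3) + k) = bit (d (3 + k))"
        using data(2)[OF that] by (simp only: add.assoc)
    qed
    then show "scan_inv n c d X Y 0 m5"
      unfolding scan_inv_def using m5(1-9) cd alt by simp
  qed
qed

lemma nodes_mem_iff: "3 \<le> k \<Longrightarrow> k < n \<Longrightarrow> k \<in> nodes n c \<longleftrightarrow> c (k - 1) \<noteq> c k"
  by (simp add: nodes_def)

lemma prog_decides: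
  fixes c d :: "nat \<Rightarrow> bool" and n :: nat
  defines "X \<equiv> nodes n c" and "Y \<equiv> nodes n d"
  assumes n: "3 \<le> n" and m: "m 0 = n" "m 1 \<le> 1"
    and data: "\<And>k. k < n - 3 \<Longrightarrow> m (Suc k) = bit (c (3 + k))"
      "\<And>k. k < n - 3 \<Longrightarrow> m (Suc (n - 3 + k)) = bit (d (3 + k))"
    and cd: "c 2" "d 2"
  shows "\<exists>t \<le> 58 * n. decides_within prog m (X \<noteq> Y \<and>
    (\<nexists>p m q. p < m \<and> m < q \<and> m \<in> X \<and> m \<in> Y \<and> (p \<in> X) \<noteq> (p \<in> Y) \<and> (q \<in> X) \<noteq> (q \<in> Y))) t"
proof -
  have low: "p \<in> X \<longleftrightarrow> p \<in> Y" if "p \<le> 2 \<or> n \<le> p" for p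
    using that n by (auto simp: X_def Y_def nodes_def)
  \<comment> \<open>No vertex up to \<open>2\<close> is exclusive, so the scan may start with count
    \<open>0\<close>.\<close>
  have "alternation X Y 2 0"
    unfolding alternation_def differs_def differs_meets_def differs_twice_def
    using low by (auto dest!: le_trans less_imp_le)
  then obtain m1 where 1: "run prog (14 * n + 52) (0, m) = (58, m1)" "scan_inv n c d X Y 0 m1"
    using prog_prepares_scan[of n m c d X Y] n m data cd by blast
  obtain t m2 where 2: "t \<le> 24 * (n - 3)" "run prog t (58, m1) = (58, m2)"
    "scan_inv n c d X Y (n - 3) m2"
    using run_scan_loop[OF 1(2) n _ , of "n - 3"] nodes_mem_iff[of _ n] unfolding X_def Y_def by auto
  have "m2 0 = 0" "m2 4 = 0" and alt: "alternation X Y (n - 1) (m2 7)"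
    using 2(3) n by (auto simp: scan_inv_def numeral_3_eq_3 numeral_2_eq_2 Suc_diff_Suc)
  then obtain u where 3: "u \<le> 6" "halted prog (run prog u (58, m2))"
    "snd (run prog u (58, m2)) 0 = bit (m2 7 = 1 \<or> m2 7 = 2)"
    using run_verdict by blast
  have run: "run prog (14 * n + 52 + t + u) (0, m) = run prog u (58, m2)"
    by (simp only: run_add[of prog "14 * n + 52 + t"] run_add[of prog "14 * n + 52"] 1 2)
  \<comment> \<open>The sum is at most
    \<open>14 * n + 52 + 24 * (n - 3) + 6 = 38 * n - 14\<close>.\<close>
  have "14 * n + 52 + t + u \<le> 58 * n" using 2(1) 3(1) n by linarith
  moreover have verdict: "m2 7 = 1 \<or> m2 7 = 2 \<longleftrightarrow> X \<noteq> Y \<and>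
    (\<nexists>p m q. p < m \<and> m < q \<and> m \<in> X \<and> m \<in> Y \<and> (p \<in> X) \<noteq> (p \<in> Y) \<and> (q \<in> X) \<noteq> (q \<in> Y))"
    by (rule alternation_verdict[OF alt]) (simp add: low)
  have "decides_within prog m (X \<noteq> Y \<and>
    (\<nexists>p m q. p < m \<and> m < q \<and> m \<in> X \<and> m \<in> Y \<and> (p \<in> X) \<noteq> (p \<in> Y) \<and> (q \<in> X) \<noteq> (q \<in> Y)))
    (14 * n + 52 + t + u)"
    unfolding decides_within_def run verdict[symmetric] using 3(2,3) by (rule conjI)
  ultimately show ?thesis by blast
qed

text \<open>Codes begin at vertex \<open>3\<close>; this justifies the bits preset for vertex
  \<open>2\<close> in \<open>setup_block\<close>.\<close>

lemma ascending_2: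
  assumes "pyr_seq n xs" "3 \<le> n" "xs ! 1 = 2"
  shows "ascending n xs 2"
proof -
  obtain us ws where x: "xs = 1 # us @ n # ws" "set us = {i. 2 \<le> i \<and> i < n \<and> ascending n xs i}"
    using pyr_seqE[OF assms(1,2)] by metis
  have "us \<noteq> []" using x(1) assms(2,3) by auto
  then have "2 \<in> set us" using x(1) assms(3) by (cases us) auto
  then show ?thesis using x(2) by simp
qed

lemma code_of_ascending: "code_of n xs = map (ascending n xs) [3..<n]"
  by (simp add: code_of_def ascending_def)

theorem theorem4:
  "\<exists>(p :: instr list) (C :: nat). \<forall>n \<ge> 3. \<forall>xs ys.
     pyr_seq n xs \<and> xs ! 1 = 2 \<and> pyr_seq n ys \<and> ys ! 1 = 2 \<longrightarrow>
     (\<exists>t \<le> C * n. decides_within p (init_mem n (code_of n xs) (code_of n ys))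
        (adjacent_vertices (PYR n) (charvec (tour_edges xs)) (charvec (tour_edges ys))) t)"
proof (rule exI[of _ prog], rule exI[of _ 58], intro allI impI)
  fix n xs ys
  assume n: "3 \<le> (n :: nat)" and "pyr_seq n xs \<and> xs ! 1 = 2 \<and> pyr_seq n ys \<and> ys ! 1 = 2"
  then have xs: "pyr_seq n xs" "xs ! 1 = 2" and ys: "pyr_seq n ys" "ys ! 1 = 2" by auto
  define m where "m = init_mem n (code_of n xs) (code_of n ys)"
  have edges: "tour_edges xs = edges_of n (nodes n (ascending n xs))"
    "tour_edges ys = edges_of n (nodes n (ascending n ys))"
    by (rule tour_edges_pyr_seq; use xs ys n in blast)+
  show "\<exists>t \<le> 58 * n. decides_within prog (init_mem n (code_of n xs) (code_of n ys))
      (adjacent_vertices (PYR n) (charvec (tour_edges xs)) (charvec (tour_edges ys))) t"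
    unfolding m_def[symmetric] edges
      adjacent_edges_of_iff[OF n nodes_in_node_sets[OF n] nodes_in_node_sets[OF n]]
  proof (rule prog_decides[OF n])
    \<comment> \<open>Cell 1 holds a code bit, or \<open>0\<close> if \<open>n = 3\<close> and both
      codes are empty.\<close>
    show "m 0 = n" "m 1 \<le> 1"
      by (simp_all add: m_def init_mem_def bit_def)
    show "m (Suc k) = bit (ascending n xs (3 + k))" if "k < n - 3" for k
      using that by (simp add: m_def init_mem_def code_of_ascending)
    show "m (Suc (n - 3 + k)) = bit (ascending n ys (3 + k))" if "k < n - 3" for k
    proof -
      have "length (code_of n xs) = n - 3" "length (code_of n ys) = n - 3"
        "code_of n ys ! k = ascending n ys (3 + k)"
        using that by (simp_all add: code_of_ascending)
      \<comment> \<open>Writing \<open>n\<close> as \<open>l + 3\<close> removes the truncated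
        subtraction from the addresses.\<close>
      moreover obtain l where "n = l + 3"
        using n le_add_diff_inverse2 by metis
      ultimately show ?thesis using that by (simp add: m_def init_mem_def)
    qed
    show "ascending n xs 2" "ascending n ys 2"
      using ascending_2 xs ys n by auto
  qed
qed

end
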